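(* The elements of the inverse $C=B^{-1}$ of the infinite element homogeneous matrix $B$ are given (recursively in the diagonal elements) by $$c(i,j)=\begin{cases}-\dfrac1{b^d}, & i=j=0,\\[2mm] \dfrac{-1+b^u\big((1-\psi)\,c(0,i-1)+\psi\,c(i-1,i-1)\big)}{b^w-b^d\gamma}, & j=i\ge1,\\[2mm] \gamma^{\,j-i}c(i,i), & j\ge i+1,\\[1mm] \big(c(j,j)-c(0,j)\big)\psi^{\,i-j}+c(0,j), & j\le i-1,\end{cases}$$ where $$\gamma=\frac{b^w-\sqrt{(b^w)^2-4b^ub^d}}{2b^d},\qquad \psi=\frac{b^w-\sqrt{(b^w)^2-4b^ub^d}}{2b^u}.$$
   Context: Let $b^d,b^u,b^z>0$ be real numbers and $b^w=b^d+b^u+b^z$. The infinite element homogeneous matrix $B=(B(i,j))_{i,j\ge0}$ is defined by: $B(0,0)=-b^d-b^u$, $B(0,1)=b^u$; $B(1,0)=b^d+b^z$, $B(1,1)=-b^w$, $B(1,2)=b^u$; and for $i\ge2$: $B(i,0)=b^z$, $B(i,i-1)=b^d$, $B(i,i)=-b^w$, $B(i,i+1)=b^u$; all other entries are $0$. $C=(c(i,j))_{i,j\ge0}$ denotes the inverse of $B$, i.e. the matrix with $BC=CB=I$ (all sums converging absolutely). *)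

theory Defs
  imports Complex_Main
begin

definition hom_matrix :: "real \<Rightarrow> real \<Rightarrow> real \<Rightarrow> nat \<Rightarrow> nat \<Rightarrow> real" where
  "hom_matrix bd bu bz i j =
    (if i = 0 then
       (if j = 0 then - bd - bu
        else if j = 1 then bu
        else 0)
     else if i = 1 then
       (if j = 0 then bd + bz
        else if j = 1 then - (bd + bu + bz)
        else if j = 2 then bu
        else 0)
     else
       (if j = 0 then bz
        else if j = i - 1 then bd
        else if j = i then - (bd + bu + bz)
        else if j = i + 1 then bu
        else 0))"

definition inf_mat_prod_is_id :: "(nat \<Rightarrow> nat \<Rightarrow> real) \<Rightarrow> (nat \<Rightarrow> nat \<Rightarrow> real) \<Rightarrow> bool" where
  "inf_mat_prod_is_id X Y \<longleftrightarrow>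
    (\<forall>i j. summable (\<lambda>k. \<bar>X i k * Y k j\<bar>) \<and>
           (\<Sum>k. X i k * Y k j) = (if i = j then 1 else 0))"

definition is_inf_mat_inverse :: "(nat \<Rightarrow> nat \<Rightarrow> real) \<Rightarrow> (nat \<Rightarrow> nat \<Rightarrow> real) \<Rightarrow> bool" where
  "is_inf_mat_inverse X Y \<longleftrightarrow> inf_mat_prod_is_id X Y \<and> inf_mat_prod_is_id Y X"

end

theory Submission
  imports Defs
begin

text \<open>
  Write \<open>(z B)\<^sub>j\<close> for the entries of a row vector times the matrix. Every row of \<open>B\<close> sums to \<open>0\<close>,
  except the row of index \<open>0\<close>, which sums to \<open>- bd\<close>. Hence for absolutely summable \<open>z\<close> the entries
  of \<open>z B\<close> add up to \<open>- bd z\<^sub>0\<close>, and the only equation of \<open>z B = e\<^sub>i\<close> that involves an infinite sum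
  (column \<open>0\<close>) can be traded for the boundary condition \<open>z\<^sub>0 = - 1 / bd\<close> (lemma \<open>left_row_iff\<close>).
  The other columns give the recurrence \<open>bu z\<^sub>j + bd z\<^sub>j\<^sub>+\<^sub>2 - bw z\<^sub>j\<^sub>+\<^sub>1 = 0\<close> away from \<open>i\<close>. Of its
  two characteristic roots, \<open>\<gamma>\<close> lies in \<open>(0,1)\<close> and the other exceeds \<open>1\<close>, so a null sequence
  solving it is a multiple of \<open>\<gamma>\<^sup>j\<close>, and it vanishes if it starts with \<open>0\<close>. Thus the
  left inverse is already unique.

  For existence, the equations of a column are those of the Green function of a random walk that is
  killed on leaving the positive half line, up to a shift by the entry of index \<open>0\<close>: if \<open>x\<close> is a column and
  \<open>y\<^sub>i = x\<^sub>i - x\<^sub>0\<close>, then \<open>y\<^sub>0 = 0\<close>, the equation of row \<open>i + 1\<close> in \<open>B x = e\<^sub>j\<close> reads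
  \<open>bd y\<^sub>i - bw y\<^sub>i\<^sub>+\<^sub>1 + bu y\<^sub>i\<^sub>+\<^sub>2 = 0\<close>, or \<open>= 1\<close> if \<open>j = i + 1\<close>, and row \<open>0\<close> links \<open>x\<^sub>0\<close> to \<open>y\<^sub>1\<close>.
  The kernel \<open>- \<gamma>\<^sup>j\<^sup>-\<^sup>i / s\<close> for \<open>i \<le> j\<close>, \<open>- \<psi>\<^sup>i\<^sup>-\<^sup>j / s\<close> for \<open>i \<ge> j\<close>, with
  \<open>s = bw - 2 bd \<gamma>\<close> the square root in the roots, solves these equations on the whole line, and
  subtracting the homogeneous solution \<open>- \<psi>\<^sup>i \<gamma>\<^sup>j / s\<close> achieves \<open>y\<^sub>0 = 0\<close>. Adding
  \<open>x\<^sub>0 = - \<gamma>\<^sup>j / bd\<close> gives a closed form of the inverse. The off-diagonal formulas are read off from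
  it, and the diagonal recursion is the equation of column \<open>i\<close> in row \<open>i\<close> of \<open>C B = I\<close>, with the
  neighbours of the diagonal element expressed through those formulas.
\<close>

section \<open>Products with the homogeneous matrix\<close>

text \<open>The case distinction in the matrix disappears once overlapping entries are added up, which
  for \<open>m = 0\<close> merges \<open>bz\<close> and \<open>bd\<close> in column \<open>0\<close>.\<close>

lemma hom_matrix_Suc_row:
  "hom_matrix bd bu bz (Suc m) k =
    (if k = 0 then bz else 0) + (if k = m then bd else 0)
      + (if k = Suc m then - (bd + bu + bz) else 0) + (if k = Suc (Suc m) then bu else 0)"
  by (cases m) (auto simp: hom_matrix_def)

lemma hom_matrix_Suc_col:
  "hom_matrix bd bu bz k (Suc m) =
    (if k = m then bu else 0) + (if k = Suc m then - (bd + bu + bz) else 0)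
      + (if k = Suc (Suc m) then bd else 0)"
  by (auto simp: hom_matrix_def)

lemma hom_matrix_0_col:
  "hom_matrix bd bu bz k 0 =
    bz + (if k = 1 then bd else 0) + (if k = 0 then - (bd + bu + bz) else 0)"
  by (auto simp: hom_matrix_def)

lemma sums_single_mult:
  fixes x :: "nat \<Rightarrow> real"
  shows "(\<lambda>k. (if k = a then c else 0) * x k) sums (c * x a)"
proof -
  have "(\<lambda>k. (if k = a then c else 0) * x k) = (\<lambda>k. if k = a then c * x k else 0)"
    by auto
  then show ?thesis using sums_single[of a "\<lambda>k. c * x k"] by simp
qed

lemma hom_matrix_0_row_sums:
  "(\<lambda>k. hom_matrix bd bu bz 0 k * x k) sums (bu * (x 1 - x 0) - bd * x 0)"
proof -
  have "(\<lambda>k. (if k = 0 then - bd - bu else 0) * x k + (if k = 1 then bu else 0) * x k)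
      sums ((- bd - bu) * x 0 + bu * x 1)"
    by (intro sums_add sums_single_mult)
  moreover have "(\<lambda>k. (if k = 0 then - bd - bu else 0) * x k + (if k = 1 then bu else 0) * x k) =
      (\<lambda>k. hom_matrix bd bu bz 0 k * x k)"
    by (auto simp: hom_matrix_def)
  ultimately show ?thesis by (simp add: algebra_simps)
qed

lemma hom_matrix_Suc_row_sums:
  "(\<lambda>k. hom_matrix bd bu bz (Suc m) k * x k) sums
    (bz * x 0 + bd * x m - (bd + bu + bz) * x (Suc m) + bu * x (Suc (Suc m)))"
proof -
  have "(\<lambda>k. (if k = 0 then bz else 0) * x k + (if k = m then bd else 0) * x k
      + (if k = Suc m then - (bd + bu + bz) else 0) * x k
      + (if k = Suc (Suc m) then bu else 0) * x k) sums
    (bz * x 0 + bd * x m + - (bd + bu + bz) * x (Suc m) + bu * x (Suc (Suc m)))"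
    by (intro sums_add sums_single_mult)
  then show ?thesis
    unfolding hom_matrix_Suc_row distrib_right by (simp add: algebra_simps)
qed

lemma hom_matrix_Suc_col_sums:
  "(\<lambda>k. z k * hom_matrix bd bu bz k (Suc m)) sums
    (bu * z m - (bd + bu + bz) * z (Suc m) + bd * z (Suc (Suc m)))"
proof -
  have "(\<lambda>k. (if k = m then bu else 0) * z k
      + (if k = Suc m then - (bd + bu + bz) else 0) * z k
      + (if k = Suc (Suc m) then bd else 0) * z k) sums
    (bu * z m + - (bd + bu + bz) * z (Suc m) + bd * z (Suc (Suc m)))"
    by (intro sums_add sums_single_mult)
  then show ?thesis
    unfolding hom_matrix_Suc_col distrib_left by (simp add: algebra_simps)
qed

lemma hom_matrix_0_col_sums:
  assumes "summable z"
  shows "(\<lambda>k. z k * hom_matrix bd bu bz k 0) sums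
    (bz * suminf z + bd * z 1 - (bd + bu + bz) * z 0)"
proof -
  have "(\<lambda>k. bz * z k + (if k = 1 then bd else 0) * z k
      + (if k = 0 then - (bd + bu + bz) else 0) * z k) sums
    (bz * suminf z + bd * z 1 + - (bd + bu + bz) * z 0)"
    by (intro sums_add sums_single_mult sums_mult summable_sums assms)
  then show ?thesis
    unfolding hom_matrix_0_col distrib_left by (simp add: algebra_simps)
qed

lemma summable_hom_matrix_row: "summable (\<lambda>k. \<bar>hom_matrix bd bu bz i k * x k\<bar>)"
  by (rule summable_finite[where N = "{..Suc i}"]) (auto simp: hom_matrix_def)

lemma summable_hom_matrix_Suc_col: "summable (\<lambda>k. \<bar>z k * hom_matrix bd bu bz k (Suc m)\<bar>)"
  by (rule summable_finite[where N = "{..Suc (Suc m)}"]) (auto simp: hom_matrix_def)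

text \<open>Column \<open>0\<close> is eventually constant and non-zero: this is where the absolute convergence of
  the products forces the rows of a left inverse to be summable.\<close>

lemma summable_hom_matrix_0_col_iff:
  fixes z :: "nat \<Rightarrow> real"
  assumes "bz > 0"
  shows "summable (\<lambda>k. \<bar>z k * hom_matrix bd bu bz k 0\<bar>) \<longleftrightarrow> summable (\<lambda>k. \<bar>z k\<bar>)"
proof -
  have "summable (\<lambda>k. \<bar>z k * hom_matrix bd bu bz k 0\<bar>) \<longleftrightarrow>
      summable (\<lambda>k. \<bar>z (k + 2) * hom_matrix bd bu bz (k + 2) 0\<bar>)"
    by (simp only: summable_iff_shift[where f = "\<lambda>k. \<bar>z k * hom_matrix bd bu bz k 0\<bar>" and k = 2])
  also have "\<dots> \<longleftrightarrow> summable (\<lambda>k. bz * \<bar>z (k + 2)\<bar>)"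
    using assms by (simp add: hom_matrix_def abs_mult mult.commute)
  also have "\<dots> \<longleftrightarrow> summable (\<lambda>k. \<bar>z k\<bar>)"
    using assms summable_iff_shift[where f = "\<lambda>k. \<bar>z k\<bar>" and k = 2]
    by (simp add: summable_cmult_iff)
  finally show ?thesis .
qed

text \<open>The row sums of the matrix are \<open>- bd, 0, 0, \<dots>\<close>, so adding the equations of all columns
  eliminates every unknown but \<open>z 0\<close>.\<close>

lemma hom_matrix_0_col_value:
  fixes z :: "nat \<Rightarrow> real"
  assumes "summable z"
    and interior: "\<And>m. bu * z m - (bd + bu + bz) * z (Suc m) + bd * z (Suc (Suc m)) =
      (if i = Suc m then 1 else 0)"
  shows "bz * suminf z + bd * z 1 - (bd + bu + bz) * z 0 = - bd * z 0 - (if i = 0 then 0 else 1)"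
proof -
  have s1: "(\<lambda>m. z (Suc m)) sums (suminf z - z 0)"
    using assms(1) by (simp add: sums_Suc_iff summable_sums)
  then have s2: "(\<lambda>m. z (Suc (Suc m))) sums (suminf z - z 0 - z 1)"
    using sums_Suc_iff[of "\<lambda>m. z (Suc m)" "suminf z - z 0 - z 1"] by simp
  have "(\<lambda>m. bu * z m - (bd + bu + bz) * z (Suc m) + bd * z (Suc (Suc m))) sums
      (bu * suminf z - (bd + bu + bz) * (suminf z - z 0) + bd * (suminf z - z 0 - z 1))"
    by (intro sums_add sums_diff sums_mult summable_sums assms(1) s1 s2)
  then have "(\<lambda>m. if i = Suc m then 1 else 0 :: real) sums
      (bu * suminf z - (bd + bu + bz) * (suminf z - z 0) + bd * (suminf z - z 0 - z 1))"
    by (simp only: interior)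
  moreover have "(\<lambda>m. if i = Suc m then 1 else 0 :: real) sums (if i = 0 then 0 else 1)"
  proof (cases i)
    case (Suc n)
    then show ?thesis using sums_single[of n "\<lambda>_. 1 :: real"] by (simp add: eq_commute)
  qed simp
  ultimately have "bu * suminf z - (bd + bu + bz) * (suminf z - z 0) + bd * (suminf z - z 0 - z 1) =
      (if i = 0 then 0 else 1)"
    by (rule sums_unique2)
  then show ?thesis by (simp add: algebra_simps)
qed

text \<open>This replaces the infinite sum in column \<open>0\<close> by a boundary condition and turns a row of
  \<open>C B = I\<close> into a boundary value problem for a three-term recurrence.\<close>

lemma left_row_iff:
  fixes z :: "nat \<Rightarrow> real"
  assumes "bd > 0" "bz > 0"
  shows "(\<forall>j. summable (\<lambda>k. \<bar>z k * hom_matrix bd bu bz k j\<bar>) \<and>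
           (\<Sum>k. z k * hom_matrix bd bu bz k j) = (if i = j then 1 else 0)) \<longleftrightarrow>
    summable (\<lambda>k. \<bar>z k\<bar>) \<and> z 0 = - 1 / bd \<and>
    (\<forall>m. bu * z m - (bd + bu + bz) * z (Suc m) + bd * z (Suc (Suc m)) =
      (if i = Suc m then 1 else 0))"
    (is "(\<forall>j. ?S j \<and> ?T j) \<longleftrightarrow> ?abs \<and> ?z0 \<and> (\<forall>m. ?I m)")
proof -
  have split: "(\<forall>j. P j) \<longleftrightarrow> P 0 \<and> (\<forall>m. P (Suc m))" for P :: "nat \<Rightarrow> bool"
    by (metis not0_implies_Suc)
  have S: "(\<forall>j. ?S j) \<longleftrightarrow> ?abs"
    unfolding split[of ?S]
    using summable_hom_matrix_0_col_iff[OF assms(2), of z] summable_hom_matrix_Suc_col by simp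
  have T_Suc: "?T (Suc m) \<longleftrightarrow> ?I m" for m
    by (simp only: sums_unique[OF hom_matrix_Suc_col_sums, symmetric])
  have T_0: "?T 0 \<longleftrightarrow> ?z0" if "?abs" "\<forall>m. ?I m"
  proof -
    have z: "summable z" using that(1) by (rule summable_rabs_cancel)
    have "?T 0 \<longleftrightarrow> - bd * z 0 - (if i = 0 then 0 else 1) = (if i = 0 then 1 else 0)"
      using that(2)
      by (simp only: sums_unique[OF hom_matrix_0_col_sums[OF z], symmetric]
          hom_matrix_0_col_value[OF z, of bu bd bz i])
    also have "\<dots> \<longleftrightarrow> ?z0" using assms(1) by (auto simp: field_simps)
    finally show ?thesis .
  qed
  have "(\<forall>j. ?S j \<and> ?T j) \<longleftrightarrow> ?abs \<and> ?T 0 \<and> (\<forall>m. ?I m)"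
    unfolding all_conj_distrib S split[of ?T] T_Suc by (rule refl)
  also have "\<dots> \<longleftrightarrow> ?abs \<and> ?z0 \<and> (\<forall>m. ?I m)"
    by (rule iffI; elim conjE; intro conjI;
        (assumption | (rule T_0[THEN iffD1] T_0[THEN iffD2], assumption+)))
  finally show ?thesis .
qed

section \<open>The closed form of the inverse\<close>

locale hom_roots =
  fixes bd bu bz \<gamma> \<psi> :: real
  assumes bd: "bd > 0" and bu: "bu > 0" and bz: "bz > 0"
    and \<gamma>_pos: "\<gamma> > 0" and \<gamma>_less: "\<gamma> < 1" and \<psi>_less: "\<psi> < 1"
    and \<gamma>_root: "bd * \<gamma>\<^sup>2 - (bd + bu + bz) * \<gamma> + bu = 0"
    and \<psi>_\<gamma>: "bu * \<psi> = bd * \<gamma>"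
begin

abbreviation bw where "bw \<equiv> bd + bu + bz"

definition disc_root where "disc_root = bw - 2 * bd * \<gamma>"

text \<open>The free kernel; since subtraction of natural numbers is truncated, one of the two factors is
  always \<open>1\<close>.\<close>

definition kern :: "nat \<Rightarrow> nat \<Rightarrow> real" where
  "kern i j = \<gamma> ^ (j - i) * \<psi> ^ (i - j)"

definition inverse_entry :: "nat \<Rightarrow> nat \<Rightarrow> real" where
  "inverse_entry i j = - (\<gamma> ^ j) / bd - (kern i j - \<psi> ^ i * \<gamma> ^ j) / disc_root"

lemma \<psi>_root: "bu * \<psi>\<^sup>2 - bw * \<psi> + bd = 0"
proof -
  have "bu * (bu * \<psi>\<^sup>2 - bw * \<psi> + bd) = (bu * \<psi>)\<^sup>2 - bw * (bu * \<psi>) + bu * bd"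
    by (simp add: algebra_simps power2_eq_square)
  also have "\<dots> = bd * (bd * \<gamma>\<^sup>2 - bw * \<gamma> + bu)"
    unfolding \<psi>_\<gamma> by (simp add: algebra_simps power2_eq_square)
  finally show ?thesis using \<gamma>_root bu by simp
qed

lemma disc_root_eq: "\<gamma> * disc_root = bu * (1 - \<psi> * \<gamma>)"
proof -
  have "bu * (1 - \<psi> * \<gamma>) = bu - bd * \<gamma>\<^sup>2"
    using \<psi>_\<gamma> by (simp add: algebra_simps power2_eq_square)
  moreover have "\<gamma> * disc_root = bw * \<gamma> - 2 * (bd * \<gamma>\<^sup>2)"
    by (simp add: disc_root_def algebra_simps power2_eq_square)
  ultimately show ?thesis using \<gamma>_root by linarith
qed

lemma disc_root_pos: "disc_root > 0"
proof -
  have "\<psi> * \<gamma> < 1 * \<gamma>"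
    using \<gamma>_pos \<psi>_less by (intro mult_strict_right_mono)
  then have "\<gamma> * disc_root > 0" unfolding disc_root_eq using bu \<gamma>_less by simp
  then show ?thesis using \<gamma>_pos by (simp add: zero_less_mult_iff)
qed

lemma \<gamma>_power_rec: "bu * \<gamma> ^ m - bw * \<gamma> ^ Suc m + bd * \<gamma> ^ Suc (Suc m) = 0"
proof -
  have "bu * \<gamma> ^ m - bw * \<gamma> ^ Suc m + bd * \<gamma> ^ Suc (Suc m) = \<gamma> ^ m * (bd * \<gamma>\<^sup>2 - bw * \<gamma> + bu)"
    by (simp add: algebra_simps power2_eq_square)
  then show ?thesis using \<gamma>_root by simp
qed

lemma \<psi>_power_rec: "bd * \<psi> ^ m - bw * \<psi> ^ Suc m + bu * \<psi> ^ Suc (Suc m) = 0"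
proof -
  have "bd * \<psi> ^ m - bw * \<psi> ^ Suc m + bu * \<psi> ^ Suc (Suc m) = \<psi> ^ m * (bu * \<psi>\<^sup>2 - bw * \<psi> + bd)"
    by (simp add: algebra_simps power2_eq_square)
  then show ?thesis using \<psi>_root by simp
qed

lemma kern_row_rec:
  "bu * kern i m - bw * kern i (Suc m) + bd * kern i (Suc (Suc m)) =
    (if i = Suc m then - disc_root else 0)"
proof (cases i "Suc m" rule: linorder_cases)
  case less
  then obtain d where "m = i + d" by (metis less_Suc_eq_le le_Suc_ex)
  then show ?thesis using \<gamma>_power_rec[of d] by (simp add: kern_def Suc_diff_le)
next
  case equal
  then show ?thesis using \<psi>_\<gamma> by (simp add: kern_def disc_root_def)
next
  case greater
  then obtain d where "i = Suc (Suc m) + d" by (metis Suc_leI le_Suc_ex)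
  then show ?thesis using \<psi>_power_rec[of d] by (simp add: kern_def Suc_diff_le algebra_simps)
qed

lemma kern_col_rec:
  "bd * kern m j - bw * kern (Suc m) j + bu * kern (Suc (Suc m)) j =
    (if Suc m = j then - disc_root else 0)"
proof (cases j "Suc m" rule: linorder_cases)
  case less
  then obtain d where "m = j + d" by (metis less_Suc_eq_le le_Suc_ex)
  then show ?thesis using \<psi>_power_rec[of d] by (simp add: kern_def Suc_diff_le)
next
  case equal
  then show ?thesis using \<psi>_\<gamma> by (auto simp add: kern_def disc_root_def)
next
  case greater
  then obtain d where "j = Suc (Suc m) + d" by (metis Suc_leI le_Suc_ex)
  then show ?thesis using \<gamma>_power_rec[of d] by (simp add: kern_def Suc_diff_le algebra_simps)
qed

lemma inverse_entry_0_row: "inverse_entry 0 j = - (\<gamma> ^ j) / bd"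
  by (simp add: inverse_entry_def kern_def)

lemma inverse_entry_0_col: "inverse_entry i 0 = - 1 / bd"
  by (simp add: inverse_entry_def kern_def)

lemma inverse_entry_right:
  assumes "i \<le> j"
  shows "inverse_entry i j = \<gamma> ^ (j - i) * inverse_entry i i"
proof -
  obtain d where "j = i + d" using assms le_Suc_ex by blast
  then show ?thesis by (simp add: inverse_entry_def kern_def power_add field_simps)
qed

lemma inverse_entry_left:
  assumes "j \<le> i"
  shows "inverse_entry i j =
    (inverse_entry j j - inverse_entry 0 j) * \<psi> ^ (i - j) + inverse_entry 0 j"
proof -
  obtain d where "i = j + d" using assms le_Suc_ex by blast
  then show ?thesis by (simp add: inverse_entry_def kern_def power_add field_simps)
qed

lemma inverse_entry_row_rec:
  "bu * inverse_entry i m - bw * inverse_entry i (Suc m) + bd * inverse_entry i (Suc (Suc m)) =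
    (if i = Suc m then 1 else 0)"
proof -
  have "bu * inverse_entry i m - bw * inverse_entry i (Suc m) + bd * inverse_entry i (Suc (Suc m)) =
    (\<psi> ^ i / disc_root - 1 / bd) * (bu * \<gamma> ^ m - bw * \<gamma> ^ Suc m + bd * \<gamma> ^ Suc (Suc m))
      - (bu * kern i m - bw * kern i (Suc m) + bd * kern i (Suc (Suc m))) / disc_root"
    by (simp add: inverse_entry_def divide_inverse algebra_simps)
  then show ?thesis
    unfolding kern_row_rec \<gamma>_power_rec using disc_root_pos by simp
qed

text \<open>The shift by the entry of index \<open>0\<close> is harmless as \<open>bz + bd - bw + bu = 0\<close>.\<close>

lemma inverse_entry_col_rec:
  "bz * inverse_entry 0 j + bd * inverse_entry m j - bw * inverse_entry (Suc m) j
      + bu * inverse_entry (Suc (Suc m)) j = (if Suc m = j then 1 else 0)"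
proof -
  have "bz * inverse_entry 0 j + bd * inverse_entry m j - bw * inverse_entry (Suc m) j
      + bu * inverse_entry (Suc (Suc m)) j =
    (\<gamma> ^ j / disc_root) * (bd * \<psi> ^ m - bw * \<psi> ^ Suc m + bu * \<psi> ^ Suc (Suc m))
      - (bd * kern m j - bw * kern (Suc m) j + bu * kern (Suc (Suc m)) j) / disc_root"
    by (simp add: inverse_entry_def[of "Suc _"] inverse_entry_def[of m] inverse_entry_0_row
        divide_inverse algebra_simps)
  then show ?thesis
    unfolding kern_col_rec \<psi>_power_rec using disc_root_pos by simp
qed

lemma inverse_entry_col_0:
  "bu * (inverse_entry 1 j - inverse_entry 0 j) - bd * inverse_entry 0 j = (if 0 = j then 1 else 0)"
proof (cases j)
  case 0
  then show ?thesis using bd by (simp add: inverse_entry_0_col)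
next
  case (Suc n)
  have "inverse_entry 1 j - inverse_entry 0 j = - (\<gamma> ^ n) * (1 - \<psi> * \<gamma>) / disc_root"
    unfolding inverse_entry_0_row by (simp add: inverse_entry_def kern_def Suc divide_inverse algebra_simps)
  then have "bu * (inverse_entry 1 j - inverse_entry 0 j) = - (\<gamma> ^ n) * (\<gamma> * disc_root) / disc_root"
    unfolding disc_root_eq by simp
  then show ?thesis
    using disc_root_pos bd by (simp add: inverse_entry_0_row Suc)
qed

lemma summable_inverse_entry: "summable (\<lambda>j. \<bar>inverse_entry i j\<bar>)"
proof -
  have "\<bar>inverse_entry i (d + i)\<bar> = \<bar>inverse_entry i i\<bar> * \<gamma> ^ d" for d
    using \<gamma>_pos inverse_entry_right[of i "d + i"] by (simp add: abs_mult)
  moreover have "summable (\<lambda>d. \<bar>inverse_entry i i\<bar> * \<gamma> ^ d)"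
    using \<gamma>_pos \<gamma>_less by (intro summable_mult summable_geometric) simp
  ultimately have "summable (\<lambda>d. \<bar>inverse_entry i (d + i)\<bar>)" by simp
  then show ?thesis
    using summable_iff_shift[where f = "\<lambda>j. \<bar>inverse_entry i j\<bar>" and k = i] by simp
qed

lemma inverse_entry_is_inverse: "is_inf_mat_inverse (hom_matrix bd bu bz) inverse_entry"
proof -
  have "(\<Sum>k. hom_matrix bd bu bz i k * inverse_entry k j) = (if i = j then 1 else 0)" for i j
  proof (cases i)
    case 0
    show ?thesis
      unfolding 0 sums_unique[OF hom_matrix_0_row_sums, symmetric] by (rule inverse_entry_col_0)
  next
    case (Suc m)
    show ?thesis
      unfolding Suc sums_unique[OF hom_matrix_Suc_row_sums, symmetric]
      by (rule inverse_entry_col_rec)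
  qed
  moreover have "\<forall>j. summable (\<lambda>k. \<bar>inverse_entry i k * hom_matrix bd bu bz k j\<bar>) \<and>
      (\<Sum>k. inverse_entry i k * hom_matrix bd bu bz k j) = (if i = j then 1 else 0)" for i
    unfolding left_row_iff[OF bd bz]
    using summable_inverse_entry inverse_entry_0_col inverse_entry_row_rec by blast
  ultimately show ?thesis
    by (simp add: is_inf_mat_inverse_def inf_mat_prod_is_id_def summable_hom_matrix_row)
qed

section \<open>Uniqueness of the left inverse\<close>

text \<open>The second characteristic root is \<open>1 / \<psi> > 1\<close>; the difference \<open>d (Suc m) - \<gamma> d m\<close>
  is multiplied by it in each step, so for a null sequence it must vanish.\<close>

lemma null_solution_zero:
  fixes d :: "nat \<Rightarrow> real"
  assumes rec: "\<And>m. bu * d m - bw * d (Suc m) + bd * d (Suc (Suc m)) = 0"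
    and lim: "d \<longlonglongrightarrow> 0" and d0: "d 0 = 0"
  shows "d m = 0"
proof -
  define e where "e m = d (Suc m) - \<gamma> * d m" for m
  have "bu * \<psi> > 0" unfolding \<psi>_\<gamma> using bd \<gamma>_pos by simp
  then have \<psi>_pos: "\<psi> > 0" using bu by (rule zero_less_mult_pos)
  have e_rec: "e m = \<psi> * e (Suc m)" for m
  proof -
    \<comment> \<open>By Vieta, \<open>bw = bd \<gamma> + bd / \<psi>\<close> and \<open>bu \<psi> = bd \<gamma>\<close>.\<close>
    have "bu * \<psi>\<^sup>2 = bd * \<gamma> * \<psi>" by (simp add: power2_eq_square flip: \<psi>_\<gamma>)
    then have bw_\<psi>: "bw * \<psi> = bd * \<gamma> * \<psi> + bd" using \<psi>_root by linarith
    have "\<psi> * (bu * d m - bw * d (Suc m) + bd * d (Suc (Suc m))) =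
        (bu * \<psi>) * d m - (bw * \<psi>) * d (Suc m) + bd * \<psi> * d (Suc (Suc m))"
      by (simp add: algebra_simps)
    also have "\<dots> = bd * (\<psi> * e (Suc m) - e m)"
      unfolding bw_\<psi> \<psi>_\<gamma> e_def by (simp add: algebra_simps)
    finally show ?thesis using bd rec[of m] by simp
  qed
  have "(\<lambda>m. d (Suc m) - \<gamma> * d m) \<longlonglongrightarrow> 0 - \<gamma> * 0"
    using lim by (rule tendsto_diff[OF LIMSEQ_Suc tendsto_mult[OF tendsto_const]]) (rule lim)
  then have e_lim: "(\<lambda>m. \<bar>e m\<bar>) \<longlonglongrightarrow> 0" by (simp add: e_def tendsto_rabs_zero)
  have e_mono: "\<bar>e m\<bar> \<le> \<bar>e (m + k)\<bar>" for m k
  proof (induction k)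
    case (Suc k)
    have "\<bar>\<psi>\<bar> * \<bar>e (Suc (m + k))\<bar> \<le> 1 * \<bar>e (Suc (m + k))\<bar>"
      using \<psi>_pos \<psi>_less by (intro mult_right_mono) auto
    then have "\<bar>e (m + k)\<bar> \<le> \<bar>e (Suc (m + k))\<bar>"
      by (simp only: e_rec[of "m + k"] abs_mult mult_1)
    with Suc show ?case by simp
  qed simp
  have "e m = 0" for m
  proof -
    have "(\<lambda>k. \<bar>e (m + k)\<bar>) \<longlonglongrightarrow> 0"
      using LIMSEQ_ignore_initial_segment[OF e_lim, of m] by (simp only: add.commute)
    then have "\<bar>e m\<bar> \<le> 0" using e_mono by (intro LIMSEQ_le_const) auto
    then show ?thesis by simp
  qed
  then have "d (Suc m) = \<gamma> * d m" for m by (simp add: e_def)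
  then show ?thesis using d0 by (induction m) auto
qed

lemma left_inverse_unique:
  assumes "inf_mat_prod_is_id C (hom_matrix bd bu bz)"
  shows "C = inverse_entry"
proof (intro ext)
  fix i j
  have "\<forall>j. summable (\<lambda>k. \<bar>C i k * hom_matrix bd bu bz k j\<bar>) \<and>
      (\<Sum>k. C i k * hom_matrix bd bu bz k j) = (if i = j then 1 else 0)"
    using assms unfolding inf_mat_prod_is_id_def by blast
  then have C: "summable (\<lambda>k. \<bar>C i k\<bar>)" "C i 0 = - 1 / bd"
      "\<And>m. bu * C i m - bw * C i (Suc m) + bd * C i (Suc (Suc m)) = (if i = Suc m then 1 else 0)"
    unfolding left_row_iff[OF bd bz] by blast+
  define d where "d k = C i k - inverse_entry i k" for k
  have "bu * d m - bw * d (Suc m) + bd * d (Suc (Suc m)) = 0" for m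
    using C(3)[of m] inverse_entry_row_rec[of i m] by (simp add: d_def algebra_simps)
  moreover have "d \<longlonglongrightarrow> 0"
    unfolding d_def
    by (rule summable_LIMSEQ_zero[OF summable_diff[OF summable_rabs_cancel[OF C(1)]
            summable_rabs_cancel[OF summable_inverse_entry]]])
  moreover have "d 0 = 0" by (simp add: d_def C(2) inverse_entry_0_col)
  ultimately have "d j = 0" by (rule null_solution_zero)
  then show "C i j = inverse_entry i j" by (simp add: d_def)
qed

lemma inverse_entry_diag_Suc:
  "inverse_entry (Suc m) (Suc m) =
    (- 1 + bu * ((1 - \<psi>) * inverse_entry 0 m + \<psi> * inverse_entry m m)) / (bw - bd * \<gamma>)"
proof -
  have "inverse_entry (Suc m) m = (1 - \<psi>) * inverse_entry 0 m + \<psi> * inverse_entry m m"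
    using inverse_entry_left[of m "Suc m"] by (simp add: algebra_simps)
  moreover have "inverse_entry (Suc m) (Suc (Suc m)) = \<gamma> * inverse_entry (Suc m) (Suc m)"
    using inverse_entry_right[of "Suc m" "Suc (Suc m)"] by (simp add: Suc_diff_le)
  ultimately have "bu * ((1 - \<psi>) * inverse_entry 0 m + \<psi> * inverse_entry m m)
      - bw * inverse_entry (Suc m) (Suc m) + bd * (\<gamma> * inverse_entry (Suc m) (Suc m)) = 1"
    using inverse_entry_row_rec[of "Suc m" m] by simp
  then have "inverse_entry (Suc m) (Suc m) * (bw - bd * \<gamma>) =
      - 1 + bu * ((1 - \<psi>) * inverse_entry 0 m + \<psi> * inverse_entry m m)"
    by (simp add: algebra_simps)
  moreover have "bw - bd * \<gamma> > 0"
    using disc_root_pos mult_pos_pos[OF bd \<gamma>_pos] unfolding disc_root_def by linarith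
  ultimately show ?thesis by (simp add: eq_divide_eq)
qed

end

section \<open>The characteristic roots and the theorem\<close>

text \<open>The polynomial is positive at \<open>0\<close> and negative at \<open>1\<close>, so its smaller root lies between them.
  With \<open>(a, b) = (bd, bu)\<close> this root is \<open>\<gamma>\<close>, with \<open>(a, b) = (bu, bd)\<close> it is \<open>\<psi>\<close>.\<close>

lemma smaller_root:
  fixes a b c :: real
  assumes "a > 0" "b > 0" "c > a + b"
  defines "x \<equiv> (c - sqrt (c\<^sup>2 - 4 * b * a)) / (2 * a)"
  shows "x > 0" "x < 1" "a * x\<^sup>2 - c * x + b = 0"
proof -
  have "(a + b)\<^sup>2 < c\<^sup>2" using assms(1-3) by (intro power_strict_mono) auto
  moreover have "(a + b)\<^sup>2 = (b - a)\<^sup>2 + 4 * b * a" by (simp add: power2_eq_square algebra_simps)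
  ultimately have D: "(b - a)\<^sup>2 < c\<^sup>2 - 4 * b * a" by linarith
  define s where "s = sqrt (c\<^sup>2 - 4 * b * a)"
  have s2: "s\<^sup>2 = c\<^sup>2 - 4 * b * a"
    unfolding s_def using D zero_le_power2[of "b - a"] by (intro real_sqrt_pow2) linarith
  have x: "2 * a * x = c - s" using assms(1) by (simp add: x_def s_def)
  have "s\<^sup>2 < c\<^sup>2" using s2 assms(1,2) by simp
  then have "s < c" by (rule power2_less_imp_less) (use assms(1-3) in simp)
  then show "x > 0" using x assms(1) zero_less_mult_pos[of "2 * a" x] by simp
  \<comment> \<open>If \<open>x \<ge> 1\<close>, then \<open>s \<le> c - 2 a\<close>, and squaring contradicts \<open>c > a + b\<close>.\<close>
  have "c - 2 * a < s"
  proof (rule power2_less_imp_less)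
    have "s\<^sup>2 - (c - 2 * a)\<^sup>2 = 4 * a * (c - (a + b))"
      unfolding s2 by (simp add: power2_eq_square algebra_simps)
    also have "\<dots> > 0" using assms(1,3) by simp
    finally show "(c - 2 * a)\<^sup>2 < s\<^sup>2" by simp
    show "0 \<le> s" using D zero_le_power2[of "b - a"] unfolding s_def by (intro real_sqrt_ge_zero) linarith
  qed
  then have "a * x < a * 1" using x by simp
  then show "x < 1" using assms(1) by simp
  have "4 * a * (a * x\<^sup>2 - c * x + b) = (2 * a * x)\<^sup>2 - 2 * c * (2 * a * x) + 4 * b * a"
    by (simp add: power2_eq_square algebra_simps)
  also have "\<dots> = 0" unfolding x using s2 by (simp add: power2_eq_square algebra_simps)
  finally show "a * x\<^sup>2 - c * x + b = 0" using assms(1) by simp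
qed

theorem mainTheorem6:
  fixes bd bu bz bw \<gamma> \<psi> :: real
    and B :: "nat \<Rightarrow> nat \<Rightarrow> real"
  assumes "bd > 0" and "bu > 0" and "bz > 0"
    and "bw = bd + bu + bz"
    and "B = hom_matrix bd bu bz"
    and "\<gamma> = (bw - sqrt (bw\<^sup>2 - 4 * bu * bd)) / (2 * bd)"
    and "\<psi> = (bw - sqrt (bw\<^sup>2 - 4 * bu * bd)) / (2 * bu)"
  shows "(\<exists>!C. is_inf_mat_inverse B C) \<and>
    (\<forall>c. is_inf_mat_inverse B c \<longrightarrow>
      c 0 0 = - 1 / bd \<and>
      (\<forall>i\<ge>1. c i i =
         (- 1 + bu * ((1 - \<psi>) * c 0 (i - 1) + \<psi> * c (i - 1) (i - 1))) / (bw - bd * \<gamma>)) \<and>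
      (\<forall>i j. j \<ge> i + 1 \<longrightarrow> c i j = \<gamma> ^ (j - i) * c i i) \<and>
      (\<forall>i j. i \<ge> j + 1 \<longrightarrow> c i j = (c j j - c 0 j) * \<psi> ^ (i - j) + c 0 j))"
proof -
  have r\<gamma>: "\<gamma> > 0" "\<gamma> < 1" "bd * \<gamma>\<^sup>2 - bw * \<gamma> + bu = 0"
    using smaller_root[of bd bu bw] assms by simp_all
  have "\<psi> = (bw - sqrt (bw\<^sup>2 - 4 * bd * bu)) / (2 * bu)"
    using assms(7) by (simp add: ac_simps)
  then have r\<psi>: "\<psi> < 1"
    using smaller_root(2)[of bu bd bw] assms(1-4) by simp
  have "bu * \<psi> = bd * \<gamma>" using assms(1,2) unfolding assms(6,7) by simp
  then interpret hom_roots bd bu bz \<gamma> \<psi>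
    using assms(1-4) r\<gamma> r\<psi> by unfold_locales auto
  have iff: "is_inf_mat_inverse B c \<longleftrightarrow> c = inverse_entry" for c
    using inverse_entry_is_inverse left_inverse_unique
    unfolding assms(5) is_inf_mat_inverse_def by blast
  have diag: "inverse_entry i i = (- 1 + bu * ((1 - \<psi>) * inverse_entry 0 (i - 1)
      + \<psi> * inverse_entry (i - 1) (i - 1))) / (bw - bd * \<gamma>)" if "i \<ge> 1" for i
    using that inverse_entry_diag_Suc[of "i - 1"] assms(4) by simp
  show ?thesis
    unfolding iff
  proof (intro conjI allI impI; (elim ssubst)?)
    show "\<exists>!C. C = inverse_entry" by (rule ex1I) (rule refl)
    show "inverse_entry 0 0 = - 1 / bd" by (rule inverse_entry_0_col)
  qed (rule diag inverse_entry_right inverse_entry_left, simp)+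
qed

end
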